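(* Let $\Phi$ be a uniformly ergodic PCA on $\mathcal{X}=S^{\mathbb{Z}^d}$ with unique invariant measure $\pi$, and for each finite set $A\subseteq\mathbb{Z}^d$ let $d_A(t)=\sup_{x\in\mathcal{X}}\|\pi(\cdot)-\Phi^t(x,\cdot)\|_A$ denote the distance from stationarity on $A$ at time $t$. Suppose there is a family of functions $\rho_n(t)$, $n\in\mathbb{N}$, such that $d_A(t)\le\rho_{|A|}(t)$ for every finite $A$ and every $t$, and $\rho_n(t)\to0$ as $t\to\infty$ for each $n$. Then the unique invariant measure $\pi$ of $\Phi$ is spatially mixing.
   Context: Let $S$ be a finite set, $d\ge 1$, and $\mathcal{X}=S^{\mathbb{Z}^d}$ with the product topology. For finite $K\subseteq\mathbb{Z}^d$ and $y_K\in S^K$, the cylinder $[y_K]$ with base $K$ is $\{x\in\mathcal{X}: x_k=y_k\ \forall k\in K\}$. The shift is $(\sigma^k x)_i=x_{k+i}$. A probabilistic cellular automaton (PCA) with neighbourhood $\{n_1,\dots,n_m\}\subseteq\mathbb{Z}^d$ and local rule $\varphi:S^m\times S\to[0,1]$ (a stochastic matrix) is the Markov kernel $\Phi$ on $\mathcal{X}$ with $\Phi(x,[y_K])=\prod_{k\in K}\varphi(x_{k+n_1},\dots,x_{k+n_m})(y_k)$ for every cylinder. $\Phi^t$ is the $t$-step kernel. A Borel probability measure $\pi$ is invariant if $\pi\Phi=\pi$. $\Phi$ is uniformly ergodic if it has a unique invariant measure $\pi$ and $\Phi^t(x,[u])\to\pi([u])$ as $t\to\infty$, uniformly in $x\in\mathcal{X}$,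 for each cylinder $[u]$. For finite $A$, $\|\mu-\nu\|_A=\frac12\sum_{u\in S^A}|\mu([u])-\nu([u])|$ is the total variation distance of the marginals on $A$. $\pi$ is spatially mixing if $\lim_{k\to\infty}\pi([u]\cap\sigma^{-k}[v])=\pi([u])\pi([v])$ for all cylinders $[u],[v]$. *)

theory Defs
  imports "HOL-Probability.Probability"
begin

type_synonym ('s, 'd) config = "int ^ 'd \<Rightarrow> 's"

text \<open>The alphabet is a type of class \<open>finite\<close>, which carries no topology, so the product topology is
  that of the abstract discrete topologies. Its Borel sets form the product sigma-algebra; see
  \<open>sets_config_space\<close> below.\<close>

definition config_space :: "('s::finite, 'd::finite) config measure" where
  "config_space = sigma UNIV {U. openin (product_topology (\<lambda>_. discrete_topology UNIV) UNIV) U}"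

text \<open>Only the values of \<open>y\<close> on \<open>K\<close> matter.\<close>

definition cylinder :: "(int ^ 'd) set \<Rightarrow> ('s, 'd::finite) config \<Rightarrow> ('s, 'd) config set" where
  "cylinder K y = {x. \<forall>k\<in>K. x k = y k}"

definition shift :: "int ^ 'd \<Rightarrow> ('s, 'd::finite) config \<Rightarrow> ('s, 'd) config" where
  "shift k x = (\<lambda>i. x (k + i))"

definition markov_kernel :: "(('s::finite, 'd::finite) config \<Rightarrow> ('s, 'd) config measure) \<Rightarrow> bool" where
  "markov_kernel \<Phi> \<longleftrightarrow> \<Phi> \<in> config_space \<rightarrow>\<^sub>M prob_algebra config_space"

definition stochastic_matrix :: "nat \<Rightarrow> ('s::finite list \<Rightarrow> 's \<Rightarrow> real) \<Rightarrow> bool" where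
  "stochastic_matrix m \<phi> \<longleftrightarrow>
     (\<forall>u. length u = m \<longrightarrow> (\<forall>s. \<phi> u s \<in> {0..1}) \<and> (\<Sum>s\<in>UNIV. \<phi> u s) = 1)"

text \<open>The list \<open>ns\<close> enumerates the neighbourhood, and words in \<open>S\<^sup>m\<close> are lists of length \<open>m\<close>.\<close>

definition pca :: "(int ^ 'd) list \<Rightarrow> ('s::finite list \<Rightarrow> 's \<Rightarrow> real) \<Rightarrow>
    (('s, 'd::finite) config \<Rightarrow> ('s, 'd) config measure) \<Rightarrow> bool" where
  "pca ns \<phi> \<Phi> \<longleftrightarrow>
     distinct ns \<and> stochastic_matrix (length ns) \<phi> \<and> markov_kernel \<Phi> \<and>
     (\<forall>x K y. finite K \<longrightarrow>
        measure (\<Phi> x) (cylinder K y) = (\<Prod>k\<in>K. \<phi> (map (\<lambda>n. x (k + n)) ns) (y k)))"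

fun kernel_power :: "(('s::finite, 'd::finite) config \<Rightarrow> ('s, 'd) config measure) \<Rightarrow> nat \<Rightarrow>
    ('s, 'd) config \<Rightarrow> ('s, 'd) config measure" where
  "kernel_power \<Phi> 0 x = return config_space x"
| "kernel_power \<Phi> (Suc t) x = kernel_power \<Phi> t x \<bind> \<Phi>"

definition invariant_measure ::
    "(('s::finite, 'd::finite) config \<Rightarrow> ('s, 'd) config measure) \<Rightarrow> ('s, 'd) config measure \<Rightarrow> bool" where
  "invariant_measure \<Phi> \<pi> \<longleftrightarrow> prob_space \<pi> \<and> sets \<pi> = sets config_space \<and> \<pi> \<bind> \<Phi> = \<pi>"

definition uniformly_ergodic ::
    "(('s::finite, 'd::finite) config \<Rightarrow> ('s, 'd) config measure) \<Rightarrow> bool" where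
  "uniformly_ergodic \<Phi> \<longleftrightarrow>
     (\<exists>\<pi>. invariant_measure \<Phi> \<pi> \<and> (\<forall>\<nu>. invariant_measure \<Phi> \<nu> \<longrightarrow> \<nu> = \<pi>) \<and>
       (\<forall>K u. finite K \<longrightarrow>
          uniform_limit UNIV (\<lambda>t x. measure (kernel_power \<Phi> t x) (cylinder K u))
            (\<lambda>x. measure \<pi> (cylinder K u)) sequentially))"

definition tv_dist_on :: "(int ^ 'd) set \<Rightarrow> ('s::finite, 'd::finite) config measure \<Rightarrow>
    ('s, 'd) config measure \<Rightarrow> real" where
  "tv_dist_on A \<mu> \<nu> =
     (1/2) * (\<Sum>u\<in>A \<rightarrow>\<^sub>E UNIV. \<bar>measure \<mu> (cylinder A u) - measure \<nu> (cylinder A u)\<bar>)"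

definition dist_from_stationarity ::
    "(('s::finite, 'd::finite) config \<Rightarrow> ('s, 'd) config measure) \<Rightarrow> ('s, 'd) config measure \<Rightarrow>
     (int ^ 'd) set \<Rightarrow> nat \<Rightarrow> real" where
  "dist_from_stationarity \<Phi> \<pi> A t = (SUP x. tv_dist_on A \<pi> (kernel_power \<Phi> t x))"

text \<open>The limit along lattice points \<open>k\<close> with \<open>\<parallel>k\<parallel> \<rightarrow> \<infinity>\<close>, in any direction; the norm is that of
  \<open>real ^ 'd\<close>, as \<open>int ^ 'd\<close> has none.\<close>

definition lattice_at_infinity :: "(int ^ 'd::finite) filter" where
  "lattice_at_infinity = filtercomap (\<lambda>k. (\<chi> i. real_of_int (k $ i)) :: real ^ 'd) at_infinity"

definition spatially_mixing :: "('s::finite, 'd::finite) config measure \<Rightarrow> bool" where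
  "spatially_mixing \<pi> \<longleftrightarrow>
     (\<forall>K L u v. finite K \<longrightarrow> finite L \<longrightarrow>
        ((\<lambda>k. measure \<pi> (cylinder K u \<inter> shift k -` cylinder L v))
           \<longlongrightarrow> measure \<pi> (cylinder K u) * measure \<pi> (cylinder L v)) lattice_at_infinity)"

lemma openin_cylinder:
  assumes "finite K"
  shows "openin (product_topology (\<lambda>_. discrete_topology UNIV) UNIV) (cylinder K y)"
proof -
  have "cylinder K y = (\<Pi>\<^sub>E k\<in>UNIV. if k \<in> K then {y k} else UNIV)"
    by (auto simp: cylinder_def PiE_def Pi_def)
  moreover have "finite {k. (if k \<in> K then {y k} else UNIV) \<noteq> UNIV}"
    by (rule finite_subset[OF _ assms]) auto
  ultimately show ?thesis
    by (simp add: openin_PiE_gen)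
qed

lemma space_config_space [simp]: "space config_space = UNIV"
  by (simp add: config_space_def space_measure_of_conv)

lemma cylinder_in_sets [measurable]:
  assumes "finite K"
  shows "cylinder K y \<in> sets config_space"
  using openin_cylinder[OF assms] by (auto simp: config_space_def intro: sigma_sets.Basic)

lemma sets_config_space:
  "sets (config_space :: ('s::finite, 'd::finite) config measure) =
   sets (PiM UNIV (\<lambda>_. count_space UNIV))" (is "_ = sets ?P")
proof (rule antisym)
  have cyl: "cylinder K y \<in> sets ?P" if "finite K" for K and y :: "('s, 'd) config"
  proof -
    have "cylinder K y = {x \<in> space ?P. \<forall>k\<in>K. x k = y k}"
      by (auto simp: cylinder_def space_PiM)
    also have "\<dots> \<in> sets ?P" using that by measurable
    finally show ?thesis .
  qed
  have "U \<in> sets ?P"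
    if U: "openin (product_topology (\<lambda>_. discrete_topology UNIV) UNIV) U" for U :: "('s, 'd) config set"
  proof -
    define C :: "('s, 'd) config set set"
      where "C = (\<Union>K\<in>Collect finite. cylinder K ` (K \<rightarrow>\<^sub>E UNIV))"
    have "countable C" unfolding C_def
      by (intro countable_UN countable_image countable_Collect_finite countable_finite finite_PiE) auto
    have "\<exists>c\<in>C. x \<in> c \<and> c \<subseteq> U" if x: "x \<in> U" for x
    proof -
      obtain V where V: "finite {i. V i \<noteq> UNIV}" "x \<in> PiE UNIV V" "PiE UNIV V \<subseteq> U"
        using U x unfolding openin_product_topology_alt by (simp, metis)
      define K where "K = {i. V i \<noteq> UNIV}"
      define y where "y = restrict x K"
      have "y \<in> K \<rightarrow>\<^sub>E UNIV" by (auto simp: y_def)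
      moreover have "x \<in> cylinder K y" by (auto simp: cylinder_def y_def)
      moreover have "cylinder K y \<subseteq> PiE UNIV V"
      proof
        fix z assume "z \<in> cylinder K y"
        then have "z i \<in> V i" for i
          using V(2) by (cases "i \<in> K") (auto simp: cylinder_def y_def K_def PiE_def Pi_def)
        then show "z \<in> PiE UNIV V" by (simp add: PiE_UNIV_domain)
      qed
      moreover have "finite K" using V(1) by (simp add: K_def)
      ultimately show ?thesis using V(3) unfolding C_def
        by (intro bexI[of _ "cylinder K y"]) auto
    qed
    then have "U = \<Union> {c \<in> C. c \<subseteq> U}" by (intro equalityI subsetI) (blast, auto)
    also have "\<dots> \<in> sets ?P"
    proof (rule sets.countable_Union)
      show "countable {c \<in> C. c \<subseteq> U}" using \<open>countable C\<close> by simp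
      show "{c \<in> C. c \<subseteq> U} \<subseteq> sets ?P" using cyl by (auto simp: C_def)
    qed
    finally show ?thesis .
  qed
  then have "sigma_sets UNIV {U. openin (product_topology (\<lambda>_. discrete_topology UNIV) UNIV) U} \<subseteq> sets ?P"
    using sets.sigma_sets_subset[of "{U. openin (product_topology (\<lambda>_. discrete_topology UNIV) UNIV) U}" ?P]
    by (simp add: space_PiM Collect_mono subset_eq)
  then show "sets (config_space :: ('s, 'd) config measure) \<subseteq> sets ?P"
    by (simp add: config_space_def)
next
  have "(\<lambda>x i. x i) \<in> config_space \<rightarrow>\<^sub>M (?P :: ('s, 'd) config measure)"
  proof (rule measurable_PiM_single')
    fix i :: "int ^ 'd"
    show "(\<lambda>x. x i) \<in> config_space \<rightarrow>\<^sub>M (count_space UNIV :: 's measure)"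
    proof (rule measurable_count_space_eq2[THEN iffD2, OF finite])
      have "(\<lambda>x. x i) -` {a} \<inter> space config_space = cylinder {i} (\<lambda>_. a)" for a :: 's
        by (auto simp: cylinder_def)
      then show "(\<lambda>x. x i) \<in> space config_space \<rightarrow> UNIV \<and>
          (\<forall>a\<in>UNIV. (\<lambda>x. x i) -` {a::'s} \<inter> space config_space \<in> sets config_space)"
        by (simp add: cylinder_in_sets)
    qed
  qed auto
  then have "A \<in> sets config_space" if "A \<in> sets ?P" for A :: "('s, 'd) config set"
    using measurable_sets[of "\<lambda>x i. x i" config_space ?P A] that by simp
  then show "sets ?P \<subseteq> sets (config_space :: ('s, 'd) config measure)" by blast
qed

end

theory Submission
  imports Defs
begin

text \<open>A PCA has finite propagation speed: the values on \<open>K\<close> at time \<open>t\<close> are determined by the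
  initial values on the \<open>t\<close>-fold neighbourhood of \<open>K\<close>, so under the deterministic initial condition
  \<open>x\<close> the restrictions of \<open>\<Phi>\<^sup>t(x, \<cdot>)\<close> to two sets with disjoint iterated neighbourhoods are
  independent. Since the rate \<open>\<rho>\<close> depends only on the cardinality, one can fix \<open>t\<close> such that
  \<open>\<Phi>\<^sup>t(x, \<cdot>)\<close> is close to \<open>\<pi>\<close> on \<open>K\<close>, \<open>k + L\<close> and \<open>K \<union> (k + L)\<close> for all \<open>k\<close> at once, and then let
  \<open>k\<close> tend to infinity. Shift invariance of \<open>\<pi>\<close> is not used directly; it is replaced by
  \<open>\<Phi>\<^sup>t(x, \<sigma>\<^sup>-\<^sup>k[v]) = \<Phi>\<^sup>t(\<sigma>\<^sup>k x, [v])\<close> and the uniformity of the convergence in \<open>x\<close>.\<close>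

section \<open>Local functions, neighbourhoods and cylinders\<close>

definition local_on :: "(int ^ 'd::finite) set \<Rightarrow> (('s, 'd) config \<Rightarrow> real) \<Rightarrow> bool" where
  "local_on A f \<longleftrightarrow> (\<forall>x y. (\<forall>k\<in>A. x k = y k) \<longrightarrow> f x = f y)"

text \<open>The Minkowski sum of \<open>K\<close> and \<open>set ns\<close>: the sites that one
  update of \<open>K\<close> reads.\<close>

definition neighbourhood :: "(int ^ 'd) list \<Rightarrow> (int ^ 'd) set \<Rightarrow> (int ^ 'd::finite) set" where
  "neighbourhood ns K = (\<Union>k\<in>K. (+) k ` set ns)"

lemma finite_neighbourhood_iterate:
  "finite K \<Longrightarrow> finite ((neighbourhood ns ^^ t) K)"
  by (induction t) (auto simp: neighbourhood_def)

lemma neighbourhood_translate: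
  "neighbourhood ns ((+) k ` K) = (+) k ` neighbourhood ns K"
  by (simp add: neighbourhood_def image_UN image_image add.assoc)

lemma neighbourhood_iterate_translate:
  "(neighbourhood ns ^^ t) ((+) k ` K) = (+) k ` (neighbourhood ns ^^ t) K"
  by (induction t) (simp_all add: neighbourhood_translate)

lemma shift_vimage_cylinder:
  "shift k -` cylinder L v = cylinder ((+) k ` L) (\<lambda>i. v (i - k))"
  by (auto simp: cylinder_def shift_def)

lemma cylinder_Int_cylinder:
  assumes "K \<inter> L = {}"
  shows "cylinder K u \<inter> cylinder L v = cylinder (K \<union> L) (\<lambda>i. if i \<in> K then u i else v i)"
  using assms by (auto simp: cylinder_def)

lemma cylinder_restrict: "cylinder A (restrict u A) = cylinder A u"
  by (auto simp: cylinder_def)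

text \<open>The cylinders with base \<open>A\<close> form a finite partition and \<open>f\<close> is
  constant on each. Integrals of local functions thus reduce to measures of cylinders.\<close>

lemma local_on_eq_sum:
  fixes f :: "('s::finite, 'd::finite) config \<Rightarrow> real"
  assumes "finite A" "local_on A f"
  shows "f x = (\<Sum>u\<in>A \<rightarrow>\<^sub>E UNIV. f u * indicator (cylinder A u) x)"
proof -
  \<comment> \<open>Words in \<open>A \<rightarrow>\<^sub>E UNIV\<close> are extensional, so exactly
    one of them has a cylinder containing \<open>x\<close>.\<close>
  have "indicator (cylinder A u) x = (if u = restrict x A then 1 else 0 :: real)"
    if "u \<in> A \<rightarrow>\<^sub>E UNIV" for u
    using that by (force simp: indicator_def cylinder_def PiE_def extensional_def fun_eq_iff)
  then have "(\<Sum>u\<in>A \<rightarrow>\<^sub>E UNIV. f u * indicator (cylinder A u) x)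
      = (\<Sum>u\<in>A \<rightarrow>\<^sub>E UNIV. if u = restrict x A then f u else 0)"
    by (intro sum.cong) auto
  also have "\<dots> = f (restrict x A)"
    using assms(1) by (subst sum.delta) (auto intro: finite_PiE)
  also have "\<dots> = f x"
    using assms(2) by (auto simp: local_on_def)
  finally show ?thesis by simp
qed

lemma local_on_mult_eq_sum:
  fixes f g :: "('s::finite, 'd::finite) config \<Rightarrow> real"
  assumes "finite A" "local_on A f" "finite B" "local_on B g"
  shows "f x * g x = (\<Sum>u\<in>A \<rightarrow>\<^sub>E UNIV. \<Sum>v\<in>B \<rightarrow>\<^sub>E UNIV.
           f u * g v * indicator (cylinder A u \<inter> cylinder B v) x)"
  unfolding local_on_eq_sum[OF assms(1,2), of x] local_on_eq_sum[OF assms(3,4), of x]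
  by (simp add: sum_product indicator_inter_arith mult_ac)

section \<open>Integrals of local functions\<close>

lemma integral_local_on:
  fixes f :: "('s::finite, 'd::finite) config \<Rightarrow> real"
  assumes "prob_space M" "sets M = sets config_space" "finite A" "local_on A f"
  shows "(\<integral>x. f x \<partial>M) = (\<Sum>u\<in>A \<rightarrow>\<^sub>E UNIV. f u * measure M (cylinder A u))"
proof -
  interpret prob_space M by fact
  have [simp]: "space M = UNIV" using sets_eq_imp_space_eq[OF assms(2)] by simp
  have [measurable]: "cylinder A u \<in> sets M" for u using assms by (simp add: cylinder_in_sets)
  show ?thesis
    by (subst local_on_eq_sum[OF assms(3,4)]) (subst Bochner_Integration.integral_sum; simp add: less_top[symmetric])
qed

text \<open>Both sides are bilinear in the cylinder indicators, so independence of the cylinders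
  suffices.\<close>

lemma integral_local_on_mult:
  fixes f g :: "('s::finite, 'd::finite) config \<Rightarrow> real"
  assumes "prob_space M" "sets M = sets config_space"
    and A: "finite A" "local_on A f" and B: "finite B" "local_on B g"
    and indep: "\<And>u v. measure M (cylinder A u \<inter> cylinder B v)
        = measure M (cylinder A u) * measure M (cylinder B v)"
  shows "(\<integral>x. f x * g x \<partial>M) = (\<integral>x. f x \<partial>M) * (\<integral>x. g x \<partial>M)"
proof -
  interpret prob_space M by fact
  have [simp]: "space M = UNIV" using sets_eq_imp_space_eq[OF assms(2)] by simp
  have [measurable]: "cylinder A u \<in> sets M" "cylinder B u \<in> sets M" for u
    using assms by (simp_all add: cylinder_in_sets)
  have "(\<integral>x. f x * g x \<partial>M) = (\<Sum>u\<in>A \<rightarrow>\<^sub>E UNIV. \<Sum>v\<in>B \<rightarrow>\<^sub>E UNIV.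
           f u * g v * measure M (cylinder A u \<inter> cylinder B v))"
    by (subst local_on_mult_eq_sum[OF A B])
       (simp add: Bochner_Integration.integral_sum Bochner_Integration.integrable_sum less_top[symmetric])
  also have "\<dots> = (\<integral>x. f x \<partial>M) * (\<integral>x. g x \<partial>M)"
    unfolding integral_local_on[OF assms(1,2) A] integral_local_on[OF assms(1,2) B]
    by (simp add: indep sum_product mult_ac)
  finally show ?thesis .
qed

lemma integral_local_on_shift:
  fixes f :: "('s::finite, 'd::finite) config \<Rightarrow> real"
  assumes "prob_space M" "sets M = sets config_space" "prob_space N" "sets N = sets config_space"
    and A: "finite A" "local_on A f"
    and eq: "\<And>u. measure M (shift k -` cylinder A u) = measure N (cylinder A u)"
  shows "(\<integral>x. f (shift k x) \<partial>M) = (\<integral>x. f x \<partial>N)"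
proof -
  interpret prob_space M by fact
  have [simp]: "space M = UNIV" using sets_eq_imp_space_eq[OF assms(2)] by simp
  have [measurable]: "shift k -` cylinder A u \<in> sets M" for u
    using assms by (simp add: shift_vimage_cylinder cylinder_in_sets)
  have "f (shift k x) = (\<Sum>u\<in>A \<rightarrow>\<^sub>E UNIV. f u * indicator (shift k -` cylinder A u) x)" for x
    by (subst local_on_eq_sum[OF A]) (simp add: indicator_def)
  then have "(\<integral>x. f (shift k x) \<partial>M)
      = (\<Sum>u\<in>A \<rightarrow>\<^sub>E UNIV. f u * measure M (shift k -` cylinder A u))"
    by (simp add: Bochner_Integration.integral_sum less_top[symmetric])
  then show ?thesis
    unfolding integral_local_on[OF assms(3,4) A] by (simp add: eq)
qed

section \<open>Iterated kernels: independence and shift covariance\<close>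

lemma kernel_power_prob:
  assumes "markov_kernel \<Phi>"
  shows "prob_space (kernel_power \<Phi> t x) \<and> sets (kernel_power \<Phi> t x) = sets config_space"
proof (induction t)
  case 0
  show ?case by (auto intro: prob_space_return)
next
  case (Suc t)
  then have M: "kernel_power \<Phi> t x \<in> space (prob_algebra config_space)"
    by (simp add: space_prob_algebra)
  show ?case
    using assms prob_space_bind'[OF M, of \<Phi> config_space] sets_bind'[OF M, of \<Phi> config_space]
    by (simp add: markov_kernel_def)
qed

lemma measure_kernel_power_Suc:
  assumes "markov_kernel \<Phi>" "C \<in> sets config_space"
  shows "measure (kernel_power \<Phi> (Suc t) x) C = (\<integral>y. measure (\<Phi> y) C \<partial>kernel_power \<Phi> t x)"
proof -
  have M: "prob_space (kernel_power \<Phi> t x)" "sets (kernel_power \<Phi> t x) = sets config_space"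
    using kernel_power_prob[OF assms(1)] by auto
  interpret prob_space "kernel_power \<Phi> t x" by fact
  have "\<Phi> \<in> kernel_power \<Phi> t x \<rightarrow>\<^sub>M subprob_algebra config_space"
    using assms(1) measurable_prob_algebraD unfolding markov_kernel_def
    by (subst measurable_cong_sets[OF M(2) refl]) auto
  from measure_bind[OF this assms(2)] show ?thesis by simp
qed

text \<open>For finite \<open>K\<close> this is the one-step probability of
  \<open>cylinder K u\<close> from \<open>x\<close>, written so that its locality in
  \<open>x\<close> is visible.\<close>

definition pca_weight :: "(int ^ 'd) list \<Rightarrow> ('s list \<Rightarrow> 's \<Rightarrow> real) \<Rightarrow>
    (int ^ 'd) set \<Rightarrow> ('s, 'd::finite) config \<Rightarrow> ('s, 'd) config \<Rightarrow> real" where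
  "pca_weight ns \<phi> K u x = (\<Prod>k\<in>K. \<phi> (map (\<lambda>n. x (k + n)) ns) (u k))"

lemma local_on_pca_weight: "local_on (neighbourhood ns K) (pca_weight ns \<phi> K u)"
  unfolding local_on_def pca_weight_def neighbourhood_def
  by (intro allI impI prod.cong refl arg_cong2[where f = \<phi>] map_cong) auto

lemma measure_kernel_power_Suc_cylinder:
  assumes "pca ns \<phi> \<Phi>" "finite K"
  shows "measure (kernel_power \<Phi> (Suc t) x) (cylinder K u)
    = (\<integral>y. pca_weight ns \<phi> K u y \<partial>kernel_power \<Phi> t x)"
  using assms by (subst measure_kernel_power_Suc) (auto simp: pca_def pca_weight_def[abs_def] cylinder_in_sets)

text \<open>At time 0 the law is a point mass. For a further step, the weight of
  \<open>K \<union> L\<close> splits into two weights, local on the neighbourhoods of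
  \<open>K\<close> and of \<open>L\<close>, and the induction hypothesis for these neighbourhoods
  factors the integral. Disjointness is asked at every \<open>s \<le> t\<close>, because for empty
  \<open>ns\<close> the later neighbourhoods are empty even when \<open>K\<close> and
  \<open>L\<close> meet.\<close>

lemma kernel_power_indep:
  assumes pca: "pca ns \<phi> \<Phi>" and "finite K" "finite L"
    and "\<And>s. s \<le> t \<Longrightarrow> (neighbourhood ns ^^ s) K \<inter> (neighbourhood ns ^^ s) L = {}"
  shows "measure (kernel_power \<Phi> t x) (cylinder K u \<inter> cylinder L v)
    = measure (kernel_power \<Phi> t x) (cylinder K u) * measure (kernel_power \<Phi> t x) (cylinder L v)"
  using assms(2-)
proof (induction t arbitrary: K L u v)
  case 0
  then show ?case
    by (simp add: measure_return cylinder_in_sets sets.Int indicator_inter_arith)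
next
  case (Suc t)
  have mk: "markov_kernel \<Phi>" using pca by (simp add: pca_def)
  let ?w = "\<lambda>i. if i \<in> K then u i else v i"
  have disj: "K \<inter> L = {}" using Suc.prems(3)[of 0] by simp
  have weight: "pca_weight ns \<phi> (K \<union> L) ?w y = pca_weight ns \<phi> K u y * pca_weight ns \<phi> L v y" for y
  proof -
    have "i \<notin> K" if "i \<in> L" for i using disj that by auto
    then show ?thesis
      unfolding pca_weight_def prod.union_disjoint[OF Suc.prems(1,2) disj]
      by (intro arg_cong2[where f = "(*)"] prod.cong) auto
  qed
  have fin: "finite (neighbourhood ns K)" "finite (neighbourhood ns L)"
    using Suc.prems finite_neighbourhood_iterate[where t = 1] by auto
  have "(neighbourhood ns ^^ s) (neighbourhood ns K) \<inter> (neighbourhood ns ^^ s) (neighbourhood ns L) = {}"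
    if "s \<le> t" for s
    using Suc.prems(3)[of "Suc s"] that by (simp add: funpow_swap1)
  note indep = Suc.IH[OF fin this]
  show ?case
    unfolding cylinder_Int_cylinder[OF disj]
      measure_kernel_power_Suc_cylinder[OF pca Suc.prems(1)]
      measure_kernel_power_Suc_cylinder[OF pca Suc.prems(2)]
      measure_kernel_power_Suc_cylinder[OF pca finite_UnI[OF Suc.prems(1,2)]] weight
    using kernel_power_prob[OF mk]
    by (intro integral_local_on_mult[OF _ _ fin(1) local_on_pca_weight fin(2) local_on_pca_weight indep])
       auto
qed

text \<open>The same \<open>\<phi>\<close> acts at every site, so the one-step weights commute with
  the shift; induction carries this through all times.\<close>

lemma kernel_power_shift:
  assumes pca: "pca ns \<phi> \<Phi>" and "finite L"
  shows "measure (kernel_power \<Phi> t x) (shift k -` cylinder L v)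
    = measure (kernel_power \<Phi> t (shift k x)) (cylinder L v)"
  using assms(2)
proof (induction t arbitrary: L v)
  case 0
  then show ?case
    by (simp add: measure_return shift_vimage_cylinder cylinder_in_sets)
       (simp add: shift_vimage_cylinder[symmetric] indicator_def)
next
  case (Suc t)
  have mk: "markov_kernel \<Phi>" using pca by (simp add: pca_def)
  have weight: "pca_weight ns \<phi> ((+) k ` L) (\<lambda>i. v (i - k)) y = pca_weight ns \<phi> L v (shift k y)" for y
    by (simp add: pca_weight_def prod.reindex shift_def add.assoc)
  have fin: "finite (neighbourhood ns L)"
    using Suc.prems finite_neighbourhood_iterate[where t = 1] by auto
  show ?case
    unfolding shift_vimage_cylinder measure_kernel_power_Suc_cylinder[OF pca Suc.prems]
      measure_kernel_power_Suc_cylinder[OF pca finite_imageI[OF Suc.prems]] weight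
    using kernel_power_prob[OF mk]
    by (intro integral_local_on_shift[OF _ _ _ _ fin local_on_pca_weight Suc.IH[OF fin]]) auto
qed

section \<open>Distance from stationarity on finite sets\<close>

lemma cylinder_diff_le_tv_dist_on:
  fixes \<mu> \<nu> :: "('s::finite, 'd::finite) config measure"
  assumes "finite A"
  shows "\<bar>measure \<mu> (cylinder A u) - measure \<nu> (cylinder A u)\<bar> \<le> 2 * tv_dist_on A \<mu> \<nu>"
proof -
  have "finite (A \<rightarrow>\<^sub>E (UNIV :: 's set))" using assms by (intro finite_PiE) auto
  \<comment> \<open>Only the restriction of \<open>u\<close> is an index of the sum; it defines the
    same cylinder.\<close>
  then have "\<bar>measure \<mu> (cylinder A (restrict u A)) - measure \<nu> (cylinder A (restrict u A))\<bar>
      \<le> (\<Sum>u\<in>A \<rightarrow>\<^sub>E UNIV. \<bar>measure \<mu> (cylinder A u) - measure \<nu> (cylinder A u)\<bar>)"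
    by (intro member_le_sum[of _ _ "\<lambda>u. \<bar>measure \<mu> (cylinder A u) - measure \<nu> (cylinder A u)\<bar>"]) auto
  then show ?thesis by (simp add: cylinder_restrict tv_dist_on_def)
qed

text \<open>A crude bound, uniform in both measures: it makes the real supremum in
  \<open>dist_from_stationarity\<close> an upper bound of its family.\<close>

lemma tv_dist_on_le:
  fixes \<mu> \<nu> :: "('s::finite, 'd::finite) config measure"
  assumes "prob_space \<mu>" "prob_space \<nu>"
  shows "tv_dist_on A \<mu> \<nu> \<le> card (A \<rightarrow>\<^sub>E (UNIV :: 's set))"
proof -
  have "\<bar>measure \<mu> C - measure \<nu> C\<bar> \<le> 1" for C
    using prob_space.prob_le_1[OF assms(1), of C] prob_space.prob_le_1[OF assms(2), of C]
      measure_nonneg[of \<mu> C] measure_nonneg[of \<nu> C] by linarith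
  then have "(\<Sum>u\<in>A \<rightarrow>\<^sub>E UNIV. \<bar>measure \<mu> (cylinder A u) - measure \<nu> (cylinder A u)\<bar>)
      \<le> real (card (A \<rightarrow>\<^sub>E (UNIV :: 's set))) * 1"
    by (intro sum_bounded_above)
  then show ?thesis by (simp add: tv_dist_on_def)
qed

lemma cylinder_diff_le_dist_from_stationarity:
  assumes "markov_kernel \<Phi>" "prob_space \<pi>" "finite A"
  shows "\<bar>measure \<pi> (cylinder A u) - measure (kernel_power \<Phi> t x) (cylinder A u)\<bar>
    \<le> 2 * dist_from_stationarity \<Phi> \<pi> A t"
proof -
  have "bdd_above (range (\<lambda>x. tv_dist_on A \<pi> (kernel_power \<Phi> t x)))"
    by (rule bdd_aboveI2, rule tv_dist_on_le) (simp_all add: assms kernel_power_prob)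
  then have "tv_dist_on A \<pi> (kernel_power \<Phi> t x) \<le> dist_from_stationarity \<Phi> \<pi> A t"
    unfolding dist_from_stationarity_def by (intro cSUP_upper) auto
  with cylinder_diff_le_tv_dist_on[OF assms(3), of \<pi> u "kernel_power \<Phi> t x"] show ?thesis by linarith
qed

section \<open>Translates by distant lattice points\<close>

lemma eventually_notin_lattice_at_infinity:
  assumes "finite F"
  shows "eventually (\<lambda>k. k \<notin> F) lattice_at_infinity"
proof -
  let ?h = "\<lambda>k :: int ^ 'd. (\<chi> i. real_of_int (k $ i)) :: real ^ 'd"
  have "bounded (?h ` F)" using assms by (intro finite_imp_bounded) auto
  then obtain b where "\<And>k. k \<in> F \<Longrightarrow> norm (?h k) \<le> b" by (auto simp: bounded_iff)
  then have "\<forall>k. b + 1 \<le> norm (?h k) \<longrightarrow> k \<notin> F" by force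
  moreover have "eventually (\<lambda>x :: real ^ 'd. b + 1 \<le> norm x) at_infinity"
    by (auto simp: eventually_at_infinity)
  ultimately show ?thesis
    unfolding lattice_at_infinity_def eventually_filtercomap by blast
qed

text \<open>The translate of \<open>G\<close> by \<open>k\<close> meets \<open>F\<close> only if
  \<open>k\<close> lies in the finite difference set \<open>F - G\<close>.\<close>

lemma eventually_disjoint_translate:
  assumes "finite F" "finite G"
  shows "eventually (\<lambda>k. F \<inter> (+) k ` G = {}) lattice_at_infinity"
proof (rule eventually_mono[OF eventually_notin_lattice_at_infinity])
  show "finite ((\<lambda>(f, g). f - g) ` (F \<times> G))" using assms by simp
  show "F \<inter> (+) k ` G = {}" if "k \<notin> (\<lambda>(f, g). f - g) ` (F \<times> G)" for k
    using that by (force simp: image_iff)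
qed

theorem proposition2p1:
  fixes ns :: "(int ^ 'd::finite) list"
    and \<phi> :: "'s::finite list \<Rightarrow> 's \<Rightarrow> real"
    and \<Phi> :: "('s, 'd) config \<Rightarrow> ('s, 'd) config measure"
    and \<pi> :: "('s, 'd) config measure"
    and \<rho> :: "nat \<Rightarrow> nat \<Rightarrow> real"
  assumes "pca ns \<phi> \<Phi>"
    and "uniformly_ergodic \<Phi>"
    and "invariant_measure \<Phi> \<pi>"
    and "\<And>A t. finite A \<Longrightarrow> dist_from_stationarity \<Phi> \<pi> A t \<le> \<rho> (card A) t"
    and "\<And>n. \<rho> n \<longlonglongrightarrow> 0"
  shows "spatially_mixing \<pi>"
  unfolding spatially_mixing_def
proof (intro allI impI tendstoI)
  fix K L :: "(int ^ 'd) set" and u v :: "('s, 'd) config" and e :: real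
  assume fin: "finite K" "finite L" and "0 < e"
  have mk: "markov_kernel \<Phi>" using assms(1) by (simp add: pca_def)
  have \<pi>: "prob_space \<pi>" using assms(3) by (simp add: invariant_measure_def)
  have close: "\<bar>measure \<pi> (cylinder A w) - measure (kernel_power \<Phi> t x) (cylinder A w)\<bar>
      \<le> 2 * \<rho> (card A) t" if "finite A" for A w t x
    using cylinder_diff_le_dist_from_stationarity[OF mk \<pi> that, of w t x] assms(4)[OF that, of t]
    by linarith
  \<comment> \<open>There are three approximation errors, each at most \<open>2 * \<rho> n t\<close>
    by \<open>close\<close>; hence \<open>e / 6\<close>.\<close>
  have small: "eventually (\<lambda>t. \<rho> n t < e / 6) sequentially" for n
    using order_tendstoD(2)[OF assms(5)[of n], of "e / 6"] \<open>0 < e\<close> by simp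
  obtain t where t: "\<rho> (card K) t < e / 6" "\<rho> (card L) t < e / 6" "\<rho> (card K + card L) t < e / 6"
    using eventually_happens'[OF _ eventually_conj[OF small[of "card K"]
        eventually_conj[OF small[of "card L"] small[of "card K + card L"]]]] by auto
  \<comment> \<open>With \<open>t\<close> fixed, only finitely many pairs of finite sets have to be
    separated.\<close>
  have "eventually (\<lambda>k. \<forall>s\<in>{..t}. (neighbourhood ns ^^ s) K \<inter> (+) k ` (neighbourhood ns ^^ s) L = {})
      lattice_at_infinity"
    using fin by (intro eventually_ball_finite ballI eventually_disjoint_translate
        finite_neighbourhood_iterate) auto
  then show "\<forall>\<^sub>F k in lattice_at_infinity. dist (measure \<pi> (cylinder K u \<inter> shift k -` cylinder L v))
      (measure \<pi> (cylinder K u) * measure \<pi> (cylinder L v)) < e"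
  proof eventually_elim
    case (elim k)
    \<comment> \<open>Any initial configuration serves: the bounds in \<open>close\<close> are
      uniform in \<open>x\<close>, and the goal does not mention it.\<close>
    fix x :: "('s, 'd) config"
    let ?P = "measure (kernel_power \<Phi> t x)" and ?D = "shift k -` cylinder L v"
    let ?A = "K \<union> (+) k ` L"
    have disj: "K \<inter> (+) k ` L = {}" using elim[THEN bspec, of 0] by simp
    have card: "card ?A = card K + card L"
      using fin disj by (simp add: card_Un_disjoint card_image)
    obtain w where w: "cylinder K u \<inter> ?D = cylinder ?A w"
      unfolding shift_vimage_cylinder cylinder_Int_cylinder[OF disj] by blast
    have indep: "?P (cylinder K u \<inter> ?D) = ?P (cylinder K u) * ?P ?D"
      unfolding shift_vimage_cylinder using elim fin
      by (intro kernel_power_indep[OF assms(1)]) (auto simp: neighbourhood_iterate_translate)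
    have 1: "\<bar>measure \<pi> (cylinder K u \<inter> ?D) - ?P (cylinder K u \<inter> ?D)\<bar> < e / 3"
      unfolding w using close[of ?A w t x] t(3) fin by (simp add: card)
    have 2: "\<bar>measure \<pi> (cylinder K u) - ?P (cylinder K u)\<bar> < e / 3"
      using close[OF fin(1), of u t x] t(1) by linarith
    \<comment> \<open>Starting from \<open>shift k x\<close> turns the event \<open>?D\<close> into
      \<open>cylinder L v\<close> itself, so the comparison is with the untranslated cylinder under
      \<open>\<pi>\<close>.\<close>
    have 3: "\<bar>measure \<pi> (cylinder L v) - ?P ?D\<bar> < e / 3"
      using close[OF fin(2), of v t "shift k x"] t(2)
      unfolding kernel_power_shift[OF assms(1) fin(2)] by linarith
    have "\<bar>?P ?D\<bar> \<le> 1" "\<bar>measure \<pi> (cylinder K u)\<bar> \<le> 1"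
      using kernel_power_prob[OF mk, of t x] \<pi> by (simp_all add: prob_space.prob_le_1)
    \<comment> \<open>These are the two terms of
      \<open>a * b - p * q = a * (b - q) + (a - p) * q\<close>, with \<open>a\<close> and
      \<open>q\<close> at most 1 in absolute value.\<close>
    then have "\<bar>measure \<pi> (cylinder K u) * (measure \<pi> (cylinder L v) - ?P ?D)\<bar>
          \<le> \<bar>measure \<pi> (cylinder L v) - ?P ?D\<bar>"
        "\<bar>(measure \<pi> (cylinder K u) - ?P (cylinder K u)) * ?P ?D\<bar>
          \<le> \<bar>measure \<pi> (cylinder K u) - ?P (cylinder K u)\<bar>"
      unfolding abs_mult by (auto intro: mult_left_le mult_left_le_one_le)
    then have "\<bar>measure \<pi> (cylinder K u) * measure \<pi> (cylinder L v) - ?P (cylinder K u) * ?P ?D\<bar>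
        \<le> \<bar>measure \<pi> (cylinder K u) - ?P (cylinder K u)\<bar> + \<bar>measure \<pi> (cylinder L v) - ?P ?D\<bar>"
      unfolding mult_diff_mult by linarith
    with 1 2 3 show ?case unfolding dist_real_def indep by linarith
  qed
qed

end
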